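(* Let $H$ be a real Hilbert space, $F:H\to H$, and $z_0\in H$. Assume: 1. the equation $F(z)=0$ has a unique solution $y\in H$; 2. $F$ is w-continuous and monotone; 3. $F$ is continuously Fréchet differentiable and there is a constant $N_1$ with $\|F'(x)\|\le N_1$ for all $x\in H$; 4. $\varepsilon:[0,\infty)\to(0,\infty)$ is continuously differentiable and tends to zero monotonically as $t\to+\infty$, and $\lim_{t\to+\infty}\dfrac{\dot\varepsilon(t)}{\varepsilon^2(t)}=0$. Let $\Phi(h,t):=-[F(h)+\varepsilon(t)(h-z_0)]$. Then the Cauchy problem $$\dot z(t)=\Phi(z(t),t),\qquad z(0)=z_0,$$ has a unique solution $z(t)$ for all $t\in[0,+\infty)$, and $$\lim_{t\to\infty}\|z(t)-y\|=0.$$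
   Context: $F$ is called w-continuous if weak convergence $x\rightharpoonup\xi$ in $H$ implies weak convergence $F(x)\rightharpoonup F(\xi)$. $F$ is monotone if $(F(x_1)-F(x_2),x_1-x_2)\ge 0$ for all $x_1,x_2\in H$. $F'$ is the Fréchet derivative; a dot denotes the derivative with respect to $t$. *)

theory Defs
  imports "HOL-Analysis.Analysis"
begin

text \<open>Real Hilbert spaces are rendered by the sort \<open>{real_inner, complete_space}\<close>.\<close>

definition weakly_converges :: "(nat \<Rightarrow> 'a::real_inner) \<Rightarrow> 'a \<Rightarrow> bool" where
  "weakly_converges x \<xi> \<longleftrightarrow> (\<forall>h. (\<lambda>n. x n \<bullet> h) \<longlonglongrightarrow> \<xi> \<bullet> h)"

text \<open>Weak continuity is meant sequentially, not with respect to nets.\<close>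

definition w_continuous :: "('a::real_inner \<Rightarrow> 'a) \<Rightarrow> bool" where
  "w_continuous F \<longleftrightarrow>
     (\<forall>x \<xi>. weakly_converges x \<xi> \<longrightarrow> weakly_converges (\<lambda>n. F (x n)) (F \<xi>))"

definition monotone_operator :: "('a::real_inner \<Rightarrow> 'a) \<Rightarrow> bool" where
  "monotone_operator F \<longleftrightarrow> (\<forall>x1 x2. (F x1 - F x2) \<bullet> (x1 - x2) \<ge> 0)"

definition \<Phi> :: "('a::real_inner \<Rightarrow> 'a) \<Rightarrow> (real \<Rightarrow> real) \<Rightarrow> 'a \<Rightarrow> 'a \<Rightarrow> real \<Rightarrow> 'a" where
  "\<Phi> F \<epsilon> z0 h t = - (F h + \<epsilon> t *\<^sub>R (h - z0))"

text \<open>Functions on \<open>[0,\<infinity>)\<close> are total functions on the reals of which only the values on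
  \<open>{0..}\<close> matter; hence the derivative at \<open>0\<close> is the one-sided one.\<close>

definition solves_Cauchy_problem ::
  "('a::real_inner \<Rightarrow> real \<Rightarrow> 'a) \<Rightarrow> 'a \<Rightarrow> (real \<Rightarrow> 'a) \<Rightarrow> bool" where
  "solves_Cauchy_problem f z0 z \<longleftrightarrow>
     z 0 = z0 \<and> (\<forall>t\<ge>0. (z has_vector_derivative f (z t) t) (at t within {0..}))"

end

theory Submission
  imports Defs
begin

text \<open>
  Let \<open>V\<^sub>e\<close> be the solution of \<open>F V + e (V - z\<^sub>0) = 0\<close>. Monotonicity gives
  \<open>\<parallel>V\<^sub>a - V\<^sub>b\<parallel>\<^sup>2 \<le> \<parallel>V\<^sub>a - z\<^sub>0\<parallel>\<^sup>2 - \<parallel>V\<^sub>b - z\<^sub>0\<parallel>\<^sup>2\<close> for \<open>0 \<le> a \<le> b\<close>, where \<open>V\<^sub>0 = y\<close>. So \<open>\<parallel>V\<^sub>e - z\<^sub>0\<parallel>\<close> increases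
  to a finite limit as \<open>e \<rightarrow> 0\<close>, the family is Cauchy, and \<open>V\<^sub>e \<rightarrow> y\<close> in norm without any appeal to
  weak compactness. The velocity of the flow satisfies \<open>\<parallel>z'\<parallel> = o(\<epsilon>)\<close>, and strong monotonicity
  of \<open>F + \<epsilon> (\<cdot> - z\<^sub>0)\<close> bounds \<open>\<parallel>z - V\<^sub>\<epsilon>\<parallel>\<close> by \<open>\<parallel>z'\<parallel> / \<epsilon>\<close>.
\<close>

section \<open>Antiderivatives of Hilbert-space-valued curves\<close>

text \<open>Cauchy-Schwarz gives one inequality, testing the functional on \<open>x\<close> itself
  the other. The isometry makes the image of the space closed in its dual and lets derivatives be
  pulled back.\<close>

lemma norm_blinfun_inner_right [simp]: "norm (blinfun_inner_right x) = norm x"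
proof (rule antisym)
  show "norm (blinfun_inner_right x) \<le> norm x"
    by (rule norm_blinfun_bound) (simp_all add: Cauchy_Schwarz_ineq2)
  have "norm x * norm x \<le> norm (blinfun_inner_right x) * norm x"
    using norm_blinfun[of "blinfun_inner_right x" x] by (simp add: norm_eq_sqrt_inner)
  then show "norm x \<le> norm (blinfun_inner_right x)"
    by (cases "x = 0") simp_all
qed

text \<open>Riemann sums are linear combinations of values of \<open>f\<close>, hence lie in
  \<open>S\<close>; they approximate \<open>I\<close> arbitrarily well, and \<open>S\<close> is
  closed.\<close>

lemma has_integral_closed_subspace:
  fixes f :: "real \<Rightarrow> 'b::real_normed_vector"
  assumes int: "(f has_integral I) {a..b}"
    and S: "subspace S" "closed S"
    and f: "\<And>x. x \<in> {a..b} \<Longrightarrow> f x \<in> S"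
  shows "I \<in> S"
proof -
  have "\<exists>s\<in>S. dist s I < e" if e: "e > 0" for e
  proof -
    obtain \<gamma> where \<gamma>: "gauge \<gamma>"
      "\<forall>\<D>. \<D> tagged_division_of {a..b} \<and> \<gamma> fine \<D> \<longrightarrow>
         norm ((\<Sum>(x, k)\<in>\<D>. measure lborel k *\<^sub>R f x) - I) < e"
      using has_integral_real[THEN iffD1, OF int, rule_format, OF e] by (elim exE conjE) (rule that)
    obtain \<D> where \<D>: "\<D> tagged_division_of {a..b}" "\<gamma> fine \<D>"
      using fine_division_exists_real[OF \<gamma>(1)] .
    have "(\<Sum>(x, k)\<in>\<D>. measure lborel k *\<^sub>R f x) \<in> S"
      by (rule subspace_sum[OF S(1)])
         (use \<D>(1) in \<open>auto intro!: subspace_scale[OF S(1)] f dest: tag_in_interval\<close>)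
    then show ?thesis
      using \<gamma>(2) \<D> by (auto simp: dist_norm)
  qed
  then have "I \<in> closure S"
    unfolding closure_approachable by blast
  then show ?thesis
    using S(2) by simp
qed

text \<open>The integral is formed in the dual space, which the embedding
  \<open>x \<mapsto> (x \<bullet> _)\<close> makes available as an instance of \<^class>\<open>banach\<close>;
  the sort \<open>{real_inner, complete_space}\<close> is not formally a subsort of that class.\<close>

lemma antiderivative_exists:
  fixes g :: "real \<Rightarrow> 'a::{real_inner, complete_space}"
  assumes g: "continuous_on {0..} g"
  obtains G where "G 0 = 0" "\<And>t. t \<ge> 0 \<Longrightarrow> (G has_vector_derivative g t) (at t within {0..})"
proof -
  let ?J = "blinfun_inner_right :: 'a \<Rightarrow> 'a \<Rightarrow>\<^sub>L real"
  have lin: "bounded_linear ?J" 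
    by (rule bounded_linear_blinfun_inner_right)
  have sub: "subspace (range ?J)"
    using subspace_UNIV bounded_linear.linear[OF lin] by (metis linear_subspace_image)
  have cl: "closed (range ?J)"
    by (rule complete_imp_closed)
       (rule complete_isometric_image[of 1], auto simp: lin complete_UNIV)
  define K where "K t = integral {0..t} (\<lambda>s. ?J (g s))" for t
  have cont: "continuous_on {0..} (\<lambda>s. ?J (g s))"
    using bounded_linear.continuous_on[OF lin g] .
  have K_range: "K t \<in> range ?J" for t
  proof -
    have "((\<lambda>s. ?J (g s)) has_integral K t) {0..t}"
      unfolding K_def
      by (intro integrable_integral integrable_continuous_interval continuous_on_subset[OF cont]) auto
    then show ?thesis
      by (rule has_integral_closed_subspace[OF _ sub cl]) auto
  qed
  \<comment> \<open>The integral never leaves the closed range of the embedding, so it can be pulled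
    back to the space itself.\<close>
  define G where "G t = inv ?J (K t)" for t
  have G: "K t = ?J (G t)" for t
    unfolding G_def by (rule f_inv_into_f[OF K_range, symmetric])
  have "norm (G 0) = norm (K 0)"
    unfolding G by (rule norm_blinfun_inner_right[symmetric])
  then have "G 0 = 0"
    by (simp add: K_def)
  moreover have "(G has_vector_derivative g t) (at t within {0..})" if t: "t \<ge> 0" for t
  proof -
    \<comment> \<open>The endpoint \<open>t+1\<close> keeps \<open>t\<close> away from the right
      end, so that the derivative within the compact interval is the derivative within
      \<open>{0..}\<close>.\<close>
    have "(K has_vector_derivative ?J (g t)) (at t within {0..t+1})"
      unfolding K_def
      by (rule integral_has_vector_derivative) (use t in \<open>auto intro: continuous_on_subset[OF cont]\<close>)
    moreover have "at t within {0..t+1} = at t within {0..}"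
      by (rule at_within_nhd[of _ "{..<t+1}"]) auto
    ultimately have "(K has_vector_derivative ?J (g t)) (at t within {0..})"
      by simp
    \<comment> \<open>By linearity and isometry the remainders of \<open>K\<close> and of
      \<open>G\<close> have the same norm, so differentiability carries over.\<close>
    moreover have "K s - K t - (s - t) *\<^sub>R ?J (g t) = ?J (G s - G t - (s - t) *\<^sub>R g t)" for s
      using bounded_linear.linear[OF lin] by (simp add: G linear_diff linear_scale)
    ultimately have "((\<lambda>s. norm (G s - G t - (s - t) *\<^sub>R g t) / norm (s - t)) \<longlongrightarrow> 0) (at t within {0..})"
      unfolding has_vector_derivative_def has_derivative_iff_norm by simp
    then show ?thesis
      unfolding has_vector_derivative_def has_derivative_iff_norm
      by (simp add: bounded_linear_scaleR_left)
  qed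
  ultimately show ?thesis
    using that by blast
qed

section \<open>Comparison inequalities\<close>

lemma at_within_atLeast: "t > a \<Longrightarrow> at t within {a..} = at (t::real)"
  by (rule at_within_interior) simp

text \<open>The mean value inequality gives \<open>M / k * (exp (k * t) - 1)\<close>, from which the
  subtracted constant is dropped. The gain \<open>1 / k\<close> is what makes a weighted integral
  operator contract.\<close>

lemma antiderivative_exp_bound:
  fixes G :: "real \<Rightarrow> 'a::real_normed_vector"
  assumes G: "G 0 = 0" "\<And>t. t \<ge> 0 \<Longrightarrow> (G has_vector_derivative g t) (at t within {0..})"
    and g: "\<And>t. t \<ge> 0 \<Longrightarrow> norm (g t) \<le> M * exp (k * t)"
    and k: "k > 0" and t: "t \<ge> 0"
  shows "norm (G t) \<le> M / k * exp (k * t)"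
proof -
  have M: "M \<ge> 0"
    using order_trans[OF norm_ge_zero g[of 0]] by simp
  show ?thesis
  proof (cases "t = 0")
    case False
    have "norm (G t - G 0) \<le> M / k * exp (k * t) - M / k * exp (k * 0)"
    proof (rule differentiable_bound_general)
      show "continuous_on {0..t} G"
        by (rule continuous_on_subset[of "{0..}"])
           (auto intro: continuous_on_vector_derivative G(2))
      show "(G has_vector_derivative g s) (at s)" if "0 < s" for s
        using G(2)[of s] that by (simp add: at_within_atLeast)
      show "((\<lambda>t. M / k * exp (k * t)) has_vector_derivative M * exp (k * s)) (at s)" for s
        unfolding has_real_derivative_iff_has_vector_derivative[symmetric]
        by (rule derivative_eq_intros refl | use k in simp)+
    qed (use False t g k in \<open>auto intro!: continuous_intros\<close>)
    moreover have "M / k \<ge> 0"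
      using M k by simp
    ultimately show ?thesis
      using G(1) by simp
  qed (use G M k in auto)
qed

text \<open>With the integrating factor \<open>exp (A t)\<close>, the product
  \<open>(S t - K) * exp (A t)\<close> has derivative
  \<open>(S' t + a t * (S t - K)) * exp (A t)\<close>, which is nonpositive. For
  \<open>a = 0\<close> this is plain monotonicity of \<open>S\<close>.\<close>

lemma gronwall_affine:
  fixes S S' A a :: "real \<Rightarrow> real"
  assumes S: "\<And>t. t \<ge> t0 \<Longrightarrow> (S has_real_derivative S' t) (at t within {t0..})"
    and A: "\<And>t. t \<ge> t0 \<Longrightarrow> (A has_real_derivative a t) (at t within {t0..})"
    and le: "\<And>t. t \<ge> t0 \<Longrightarrow> S' t \<le> - a t * (S t - K)"
    and t: "t \<ge> t0"
  shows "S t \<le> K + (S t0 - K) * exp (A t0 - A t)"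
proof -
  have "(S t - K) * exp (A t) \<le> (S t0 - K) * exp (A t0)"
  proof (rule DERIV_nonpos_imp_decreasing_open[OF t])
    fix x assume x: "t0 < x" "x < t"
    have "((\<lambda>t. (S t - K) * exp (A t)) has_real_derivative (S' x + a x * (S x - K)) * exp (A x)) (at x)"
      using S[of x] A[of x] x
      by (auto simp: at_within_atLeast algebra_simps intro!: derivative_eq_intros)
    moreover have "(S' x + a x * (S x - K)) * exp (A x) \<le> 0"
      using le[of x] x by (intro mult_nonpos_nonneg) auto
    ultimately show "\<exists>y. ((\<lambda>t. (S t - K) * exp (A t)) has_real_derivative y) (at x) \<and> y \<le> 0"
      by blast
  next
    have "continuous_on {t0..} S" "continuous_on {t0..} A"
      using S A by (auto intro!: DERIV_continuous_on)
    then show "continuous_on {t0..t} (\<lambda>t. (S t - K) * exp (A t))"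
      by (auto intro!: continuous_intros elim: continuous_on_subset)
  qed
  then have "(S t - K) * exp (A t) * exp (- A t) \<le> (S t0 - K) * exp (A t0) * exp (- A t)"
    by (rule mult_right_mono) simp
  then show ?thesis
    by (simp add: mult.assoc flip: exp_add)
qed

lemma DERIV_norm_power2:
  fixes u :: "real \<Rightarrow> 'a::real_inner"
  assumes "(u has_vector_derivative u') (at t within S)"
  shows "((\<lambda>t. (norm (u t))\<^sup>2) has_real_derivative 2 * (u' \<bullet> u t)) (at t within S)"
  unfolding power2_norm_eq_inner has_field_derivative_def
  by (rule has_derivative_eq_rhs[OF has_derivative_inner])
     (use assms in \<open>auto simp: has_vector_derivative_def fun_eq_iff inner_commute\<close>)

section \<open>Global existence and uniqueness for the Cauchy problem\<close>

text \<open>Picard's fixed point argument in an exponentially weighted sup norm: the weight makes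
  the integral operator a contraction on the whole half-line at once, so no continuation of local
  solutions is required.\<close>

lemma Cauchy_problem_exists:
  fixes f :: "'a::{real_inner, complete_space} \<Rightarrow> real \<Rightarrow> 'a"
  assumes cont: "continuous_on (UNIV \<times> {0..}) (\<lambda>(x, t). f x t)"
    and lip: "\<And>x y t. t \<ge> 0 \<Longrightarrow> norm (f x t - f y t) \<le> L * norm (x - y)"
    and bnd: "\<And>t. t \<ge> 0 \<Longrightarrow> norm (f z0 t) \<le> B"
    and L: "L > 0"
  shows "\<exists>z. solves_Cauchy_problem f z0 z"
proof -
  \<comment> \<open>A bounded continuous \<open>u\<close> encodes the curve \<open>x u\<close>. The
    rate \<open>2 * L\<close> is twice the Lipschitz constant, so that integration yields the
    contraction factor \<open>L / (2 * L) = 1/2\<close>.\<close>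
  define x where "x u s = z0 + exp (2 * L * s) *\<^sub>R apply_bcontfun u s" for u s
  define g where "g u s = f (x u s) s" for u s
  have g_cont: "continuous_on {0..} (g u)" for u
  proof -
    have "continuous_on {0..} (\<lambda>s. (x u s, s))"
      unfolding x_def by (intro continuous_intros continuous_on_apply_bcontfun)
    then show ?thesis
      using continuous_on_compose2[OF cont, of "{0..}" "\<lambda>s. (x u s, s)"]
      by (simp add: g_def image_subset_iff)
  qed
  have "\<exists>G. G 0 = 0 \<and> (\<forall>t\<ge>0. (G has_vector_derivative g u t) (at t within {0..}))" for u
    by (rule antiderivative_exists[OF g_cont]) blast
  then obtain G where G0: "\<And>u. G u 0 = 0"
    and G: "\<And>u t. t \<ge> 0 \<Longrightarrow> (G u has_vector_derivative g u t) (at t within {0..})"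
    by metis
  \<comment> \<open>Bounded continuous functions here live on all reals; \<open>max 0 t\<close>
    extends \<open>T u\<close> by its value at \<open>0\<close>, which is zero.\<close>
  define T where "T u t = exp (- (2 * L * max 0 t)) *\<^sub>R G u (max 0 t)" for u t
  have expL: "exp (2 * L * t) \<ge> 1" if "t \<ge> 0" for t
    using L that by simp
  have T_bcontfun: "T u \<in> bcontfun" for u
  proof (rule bcontfun_normI)
    have "continuous_on {0..} (G u)"
      using G by (auto intro: continuous_on_vector_derivative)
    then have "continuous_on UNIV (\<lambda>t. G u (max 0 t))"
      by (rule continuous_on_compose2) (auto intro!: continuous_intros)
    then show "continuous_on UNIV (T u)"
      unfolding T_def by (intro continuous_intros)
  next
    fix t :: real
    have B: "B \<ge> 0"
      using order_trans[OF norm_ge_zero bnd[of 0]] by simp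
    \<comment> \<open>Comparing with the constant curve \<open>z0\<close> shows linear growth in the
      weighted variable, hence boundedness of \<open>T u\<close>.\<close>
    have "norm (g u s) \<le> (B + L * norm u) * exp (2 * L * s)" if s: "s \<ge> 0" for s
    proof -
      have "norm (g u s) \<le> norm (f z0 s) + norm (f (x u s) s - f z0 s)"
        unfolding g_def by norm
      also have "\<dots> \<le> B + L * (exp (2 * L * s) * norm u)"
        using lip[OF s, of "x u s" z0] bnd[OF s] norm_bounded[of u s] L
        by (intro add_mono) (auto simp: x_def elim!: order_trans intro!: mult_left_mono)
      also have "\<dots> \<le> B * exp (2 * L * s) + L * (exp (2 * L * s) * norm u)"
        using mult_left_mono[OF expL[OF s] B] by simp
      finally show ?thesis
        by (simp add: algebra_simps)
    qed
    then have "norm (G u (max 0 t)) \<le> (B + L * norm u) / (2 * L) * exp (2 * L * max 0 t)"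
      using L by (intro antiderivative_exp_bound[OF G0 G]) auto
    then have "exp (- (2 * L * max 0 t)) * norm (G u (max 0 t)) \<le>
        exp (- (2 * L * max 0 t)) * ((B + L * norm u) / (2 * L) * exp (2 * L * max 0 t))"
      by (rule mult_left_mono) simp
    also have "\<dots> = (B + L * norm u) / (2 * L)"
      by (simp add: exp_minus)
    finally show "norm (T u t) \<le> (B + L * norm u) / (2 * L)"
      by (simp add: T_def)
  qed
  have "\<exists>!u. Bcontfun (T u) = u"
  proof (rule banach_fix_type[of "1/2"], simp, simp, intro allI)
    fix u v
    show "dist (Bcontfun (T u)) (Bcontfun (T v)) \<le> 1/2 * dist u v"
    proof (rule dist_bound)
      fix t :: real
      have "norm (g u s - g v s) \<le> (L * dist u v) * exp (2 * L * s)" if s: "s \<ge> 0" for s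
      proof -
        have "norm (g u s - g v s) \<le> L * (exp (2 * L * s) * dist (u s) (v s))"
          using lip[OF s, of "x u s" "x v s"]
          by (simp add: g_def x_def dist_norm scaleR_diff_right[symmetric] del: scaleR_diff_right)
        also have "\<dots> \<le> L * (exp (2 * L * s) * dist u v)"
          using L dist_bounded[of u s v] by simp
        finally show ?thesis
          by (simp add: mult_ac)
      qed
      then have "norm (G u (max 0 t) - G v (max 0 t)) \<le> L * dist u v / (2 * L) * exp (2 * L * max 0 t)"
        using L by (intro antiderivative_exp_bound[of "\<lambda>t. G u t - G v t" "\<lambda>t. g u t - g v t"])
          (auto intro!: derivative_eq_intros G simp: G0)
      then have "exp (- (2 * L * max 0 t)) * norm (G u (max 0 t) - G v (max 0 t)) \<le>
          exp (- (2 * L * max 0 t)) * (L * dist u v / (2 * L) * exp (2 * L * max 0 t))"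
        by (rule mult_left_mono) simp
      also have "\<dots> = L * dist u v / (2 * L)"
        by (simp add: exp_minus)
      finally have "norm (T u t - T v t) \<le> dist u v / 2"
        using L by (simp add: T_def flip: scaleR_diff_right)
      then show "dist (Bcontfun (T u) t) (Bcontfun (T v) t) \<le> 1/2 * dist u v"
        by (simp add: Bcontfun_inverse T_bcontfun dist_norm)
    qed
  qed
  then obtain u where "Bcontfun (T u) = u"
    by blast
  then have "apply_bcontfun u = T u"
    using Bcontfun_inverse[OF T_bcontfun, of u] by simp
  \<comment> \<open>Removing the weight turns the fixed point equation into the integral
    equation.\<close>
  then have xG: "x u t = z0 + G u t" if "t \<ge> 0" for t
    using that by (simp add: x_def T_def exp_minus)
  have "(x u has_vector_derivative f (x u t) t) (at t within {0..})" if t: "t \<ge> 0" for t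
  proof (rule has_vector_derivative_transform[where f = "\<lambda>t. z0 + G u t"])
    show "((\<lambda>t. z0 + G u t) has_vector_derivative f (x u t) t) (at t within {0..})"
      using G[OF t, of u] by (auto intro!: derivative_eq_intros simp: g_def)
  qed (use t xG in auto)
  then show ?thesis
    unfolding solves_Cauchy_problem_def using xG[of 0] G0 by (intro exI[of _ "x u"]) simp
qed

text \<open>The squared distance of two solutions starts at \<open>0\<close> and has nonpositive
  derivative.\<close>

lemma Cauchy_problem_unique:
  fixes f :: "'a::real_inner \<Rightarrow> real \<Rightarrow> 'a"
  assumes z: "solves_Cauchy_problem f z0 z" and w: "solves_Cauchy_problem f z0 w"
    and dissipative: "\<And>x y t. t \<ge> 0 \<Longrightarrow> (f x t - f y t) \<bullet> (x - y) \<le> 0"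
    and t: "t \<ge> 0"
  shows "w t = z t"
proof -
  have "(norm (w t - z t))\<^sup>2 \<le> 0 + ((norm (w 0 - z 0))\<^sup>2 - 0) * exp (0 - 0)"
  proof (rule gronwall_affine[where a = "\<lambda>_. 0" and t = t, OF DERIV_norm_power2])
    show "((\<lambda>t. w t - z t) has_vector_derivative f (w t) t - f (z t) t) (at t within {0..})"
      if "t \<ge> 0" for t
      using z w that unfolding solves_Cauchy_problem_def by (auto intro!: derivative_eq_intros)
  qed (use dissipative t in \<open>auto simp: mult_le_0_iff\<close>)
  then show ?thesis
    using z w by (simp add: solves_Cauchy_problem_def)
qed

section \<open>The regularized equation and its limit for vanishing parameter\<close>

text \<open>Adding \<open>e\<close> times the displacement makes the operator strongly monotone with
  constant \<open>e\<close> and Lipschitz with constant \<open>N + e\<close>; a sufficiently damped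
  step against it is then a contraction.\<close>

lemma regularized_solution_exists:
  fixes F :: "'a::{real_inner, complete_space} \<Rightarrow> 'a"
  assumes mono: "monotone_operator F"
    and lip: "\<And>x y. norm (F x - F y) \<le> N * norm (x - y)"
    and N: "N \<ge> 0" and e: "e > 0"
  shows "\<exists>v. F v + e *\<^sub>R (v - z0) = 0"
proof -
  define G where "G x = F x + e *\<^sub>R (x - z0)" for x
  define L where "L = N + e"
  \<comment> \<open>The step length \<open>e / L\<^sup>2\<close> minimizes
    \<open>1 - 2 * s * e + s\<^sup>2 * L\<^sup>2\<close> over \<open>s\<close>; the minimum
    \<open>1 - (e / L)\<^sup>2\<close> is the squared contraction factor.\<close>
  define T where "T x = x - (e / L\<^sup>2) *\<^sub>R G x" for x
  have L: "L > 0" "e \<le> L"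
    using N e by (auto simp: L_def)
  have "\<exists>!x. T x = x"
  proof (rule banach_fix_type[of "sqrt (1 - (e / L)\<^sup>2)"], safe)
    show "0 \<le> sqrt (1 - (e / L)\<^sup>2)"
      using L e by (simp add: power_le_one divide_simps)
    show "sqrt (1 - (e / L)\<^sup>2) < 1"
      using L e by (simp add: power_le_one divide_simps)
  next
    fix x y
    define d g where "d = x - y" and "g = G x - G y"
    have geq: "g = (F x - F y) + e *\<^sub>R d"
      by (simp add: g_def d_def G_def algebra_simps)
    have "g \<bullet> d \<ge> e * (norm d)\<^sup>2"
      using mono unfolding monotone_operator_def
      by (simp add: geq d_def inner_add_left power2_norm_eq_inner)
    then have "2 * (e / L\<^sup>2) * (e * (norm d)\<^sup>2) \<le> 2 * (e / L\<^sup>2) * (g \<bullet> d)"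
      using e L by (intro mult_left_mono) auto
    moreover have "norm g \<le> L * norm d"
      using norm_triangle_ineq[of "F x - F y" "e *\<^sub>R d"] lip[of x y] e
      unfolding geq L_def d_def by (simp add: distrib_right)
    then have "(norm g)\<^sup>2 \<le> L\<^sup>2 * (norm d)\<^sup>2"
      using power_mono[of "norm g" "L * norm d" 2] by (simp add: power_mult_distrib)
    then have "(e / L\<^sup>2)\<^sup>2 * (norm g)\<^sup>2 \<le> (e / L\<^sup>2)\<^sup>2 * (L\<^sup>2 * (norm d)\<^sup>2)"
      by (intro mult_left_mono) auto
    moreover have "(norm (T x - T y))\<^sup>2 = (norm (d - (e / L\<^sup>2) *\<^sub>R g))\<^sup>2"
      by (simp add: T_def d_def g_def algebra_simps)
    moreover have "\<dots> = (norm d)\<^sup>2 - 2 * (e / L\<^sup>2) * (g \<bullet> d) + (e / L\<^sup>2)\<^sup>2 * (norm g)\<^sup>2"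
      unfolding power2_norm_eq_inner
      by (simp add: inner_diff inner_commute algebra_simps power2_eq_square)
    moreover have "(e / L\<^sup>2)\<^sup>2 * (L\<^sup>2 * (norm d)\<^sup>2) = (e / L)\<^sup>2 * (norm d)\<^sup>2"
      "2 * (e / L\<^sup>2) * (e * (norm d)\<^sup>2) = 2 * (e / L)\<^sup>2 * (norm d)\<^sup>2"
      using L by (simp_all add: field_simps power2_eq_square)
    ultimately have "(norm (T x - T y))\<^sup>2 \<le> (1 - (e / L)\<^sup>2) * (norm d)\<^sup>2"
      unfolding left_diff_distrib by linarith
    then have "norm (T x - T y) \<le> sqrt ((1 - (e / L)\<^sup>2) * (norm d)\<^sup>2)"
      by (rule real_le_rsqrt)
    then show "dist (T x) (T y) \<le> sqrt (1 - (e / L)\<^sup>2) * dist x y"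
      by (simp add: dist_norm d_def real_sqrt_mult)
  qed
  then obtain v where "T v = v"
    by blast
  then have "G v = 0"
    using e L by (auto simp: T_def)
  then show ?thesis
    unfolding G_def by blast
qed

lemma regularized_solution_diff:
  assumes mono: "monotone_operator F"
    and u: "F u + a *\<^sub>R (u - z0) = 0" and v: "F v + b *\<^sub>R (v - z0) = 0"
    and ab: "0 \<le> a" "a \<le> b" "0 < b"
  shows "(norm (u - v))\<^sup>2 \<le> (norm (u - z0))\<^sup>2 - (norm (v - z0))\<^sup>2"
proof -
  define p q where "p = u - z0" and "q = v - z0"
  have F: "F u = - (a *\<^sub>R p)" "F v = - (b *\<^sub>R q)"
    using u v by (simp_all add: p_def q_def add_eq_0_iff2)
  have pq: "p - q = u - v"
    by (simp add: p_def q_def)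
  have "(F u - F v) \<bullet> (p - q) \<ge> 0"
    unfolding pq using mono by (simp add: monotone_operator_def)
  then have "(b *\<^sub>R q - a *\<^sub>R p) \<bullet> (p - q) \<ge> 0"
    unfolding F by simp
  moreover have "2 * ((b *\<^sub>R q - a *\<^sub>R p) \<bullet> (p - q)) =
      (b - a) * ((norm p)\<^sup>2 - (norm q)\<^sup>2) - (a + b) * (norm (p - q))\<^sup>2"
    unfolding power2_norm_eq_inner by (simp add: inner_diff inner_commute algebra_simps)
  ultimately have *: "(a + b) * (norm (p - q))\<^sup>2 \<le> (b - a) * ((norm p)\<^sup>2 - (norm q)\<^sup>2)"
    by linarith
  have "(norm (p - q))\<^sup>2 \<le> (norm p)\<^sup>2 - (norm q)\<^sup>2"
  \<comment> \<open>For \<open>a = b\<close> the right side of \<open>*\<close> vanishes and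
    \<open>p = q\<close> follows from \<open>a + b > 0\<close>; otherwise \<open>b - a\<close> can
    be cancelled.\<close>
  proof (cases "a = b")
    case True
    then show ?thesis
      using * ab by (simp add: mult_le_0_iff)
  next
    case False
    have "(b - a) * (norm (p - q))\<^sup>2 \<le> (a + b) * (norm (p - q))\<^sup>2"
      using ab by (intro mult_right_mono) auto
    then have "(b - a) * (norm (p - q))\<^sup>2 \<le> (b - a) * ((norm p)\<^sup>2 - (norm q)\<^sup>2)"
      using * by linarith
    then show ?thesis
      using False ab by (simp add: mult_le_cancel_left)
  qed
  then show ?thesis
    by (simp add: p_def q_def)
qed

text \<open>Monotonicity and boundedness of \<open>f\<close> give a limit along one sequence of
  parameters; continuity and uniqueness identify it as \<open>y\<close>, and monotonicity of
  \<open>f\<close> extends the convergence to all small parameters.\<close>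

lemma regularized_solution_tendsto:
  fixes F :: "'a::{real_inner, complete_space} \<Rightarrow> 'a"
  assumes mono: "monotone_operator F" and cont: "continuous_on UNIV F"
    and y: "F y = 0" and uniq: "\<And>z. F z = 0 \<Longrightarrow> z = y"
    and V: "\<And>e. e > 0 \<Longrightarrow> F (V e) + e *\<^sub>R (V e - z0) = 0"
  shows "(V \<longlongrightarrow> y) (at_right 0)"
proof -
  define f where "f e = (norm (V e - z0))\<^sup>2" for e
  have diff: "(norm (V a - V b))\<^sup>2 \<le> f a - f b" if "0 < a" "a \<le> b" for a b
    unfolding f_def using that by (intro regularized_solution_diff[OF mono V V]) auto
  have anti: "f b \<le> f a" if "0 < a" "a \<le> b" for a b
    using order_trans[OF zero_le_power2 diff[OF that]] by simp
  have diff_y: "(norm (y - V b))\<^sup>2 \<le> (norm (y - z0))\<^sup>2 - f b" if "0 < b" for b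
    unfolding f_def using that y
    by (intro regularized_solution_diff[OF mono _ V, where a = 0]) auto
  define c where "c n = 1 / real (Suc n)" for n
  have c: "c n > 0" "n \<le> m \<Longrightarrow> c m \<le> c n" for n m
    by (auto simp: c_def frac_le)
  have "incseq (\<lambda>n. f (c n))"
    using anti[OF c(1) c(2)] by (simp add: incseq_def)
  moreover have "f (c n) \<le> (norm (y - z0))\<^sup>2" for n
    using order_trans[OF zero_le_power2 diff_y[OF c(1)]] by simp
  ultimately have "convergent (\<lambda>n. f (c n))"
    using incseq_convergent by (metis convergent_def)
  then have "Cauchy (\<lambda>n. f (c n))"
    by (rule convergent_Cauchy)
  have "Cauchy (\<lambda>n. V (c n))"
  proof (rule metric_CauchyI)
    fix e :: real assume e: "e > 0"
    then obtain M where M: "\<And>m n. m \<ge> M \<Longrightarrow> n \<ge> M \<Longrightarrow> dist (f (c m)) (f (c n)) < e\<^sup>2"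
      using metric_CauchyD[OF \<open>Cauchy (\<lambda>n. f (c n))\<close>, of "e\<^sup>2"] by auto
    have *: "dist (V (c m)) (V (c n)) < e" if "m \<ge> n" "n \<ge> M" for m n
    proof -
      have "(dist (V (c m)) (V (c n)))\<^sup>2 < e\<^sup>2"
        using diff[OF c(1) c(2)[OF that(1)]] M[of m n] that by (auto simp: dist_norm)
      then show ?thesis
        using e by (intro power2_less_imp_less[of _ e]) auto
    qed
    show "\<exists>M. \<forall>m\<ge>M. \<forall>n\<ge>M. dist (V (c m)) (V (c n)) < e"
      using * by (metis dist_commute nle_le)
  qed
  then obtain \<xi> where \<xi>: "(\<lambda>n. V (c n)) \<longlonglongrightarrow> \<xi>"
    using Cauchy_convergent_iff convergent_def by blast
  have "c \<longlonglongrightarrow> 0"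
    unfolding c_def by (rule lim_1_over_n[THEN LIMSEQ_Suc, unfolded comp_def])
  then have "(\<lambda>n. F (V (c n)) + c n *\<^sub>R (V (c n) - z0)) \<longlonglongrightarrow> F \<xi> + 0 *\<^sub>R (\<xi> - z0)"
    by (intro tendsto_intros \<xi> continuous_on_tendsto_compose[OF cont]) auto
  then have "F \<xi> = 0"
    using V[OF c(1)] by (simp add: LIMSEQ_const_iff)
  then have "(\<lambda>n. V (c n)) \<longlonglongrightarrow> y"
    using uniq \<xi> by auto
  \<comment> \<open>Convergence to \<open>y\<close> closes the gap on the right of
    \<open>diff_y\<close>. As \<open>f\<close> is antitone, the gap at \<open>c n\<close> dominates
    the gap at every smaller parameter.\<close>
  then have lim: "(\<lambda>n. (norm (y - z0))\<^sup>2 - f (c n)) \<longlonglongrightarrow> (norm (y - z0))\<^sup>2 - (norm (y - z0))\<^sup>2"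
    unfolding f_def by (intro tendsto_intros)
  show ?thesis
    unfolding tendsto_iff
  proof safe
    fix e :: real assume e: "e > 0"
    then have "eventually (\<lambda>n. (norm (y - z0))\<^sup>2 - f (c n) < e\<^sup>2) sequentially"
      using order_tendstoD(2)[OF lim, of "e\<^sup>2"] by simp
    then obtain n where n: "(norm (y - z0))\<^sup>2 - f (c n) < e\<^sup>2"
      using eventually_sequentially by auto
    have "dist (V a) y < e" if a: "0 < a" "a < c n" for a
    proof -
      have "(dist (V a) y)\<^sup>2 \<le> (norm (y - z0))\<^sup>2 - f a"
        using diff_y[OF a(1)] by (simp add: dist_norm norm_minus_commute)
      moreover have "f (c n) \<le> f a"
        using anti[of a "c n"] a by simp
      ultimately have "(dist (V a) y)\<^sup>2 < e\<^sup>2"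
        using n by simp
      then show ?thesis
        using e by (intro power2_less_imp_less[of _ e]) auto
    qed
    then show "eventually (\<lambda>a. dist (V a) y < e) (at_right 0)"
      unfolding eventually_at_right_field using c(1) by blast
  qed
qed

section \<open>Estimates along the flow and its convergence\<close>

text \<open>On the line through \<open>x\<close> in direction \<open>h\<close>, a negative
  derivative of \<open>\<phi>\<close> at \<open>0\<close> would make \<open>\<phi>\<close> drop just
  to the right, against monotonicity.\<close>

lemma monotone_operator_derivative_nonneg:
  assumes mono: "monotone_operator F" and D: "(F has_derivative D) (at x)"
  shows "D h \<bullet> h \<ge> 0"
proof (rule ccontr)
  assume neg: "\<not> D h \<bullet> h \<ge> 0"
  define \<phi> where "\<phi> s = F (x + s *\<^sub>R h) \<bullet> h" for s
  have "((\<lambda>s. F (x + s *\<^sub>R h)) has_derivative (\<lambda>s. D (s *\<^sub>R h))) (at 0)"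
    by (rule has_derivative_compose[of "\<lambda>s. x + s *\<^sub>R h" _ _ _ F, simplified])
       (use D in \<open>auto intro!: derivative_eq_intros\<close>)
  then have "(\<phi> has_derivative (\<lambda>s. D (s *\<^sub>R h) \<bullet> h)) (at 0)"
    unfolding \<phi>_def by (rule has_derivative_inner_left)
  then have "DERIV \<phi> 0 :> D h \<bullet> h"
    unfolding has_field_derivative_def
    using linear_scale[OF has_derivative_linear[OF D]]
    by (simp add: mult_commute_abs)
  then obtain d where d: "d > 0" "\<And>s. 0 < s \<Longrightarrow> s < d \<Longrightarrow> \<phi> s < \<phi> 0"
    using DERIV_neg_dec_right[of \<phi> "D h \<bullet> h" 0] neg by (metis add_0 not_le)
  have "(F (x + (d / 2) *\<^sub>R h) - F x) \<bullet> (d / 2) *\<^sub>R h \<ge> 0"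
    using mono unfolding monotone_operator_def by (metis add_diff_cancel_left')
  then have "\<phi> (d / 2) \<ge> \<phi> 0"
    using d(1) by (simp add: \<phi>_def inner_diff_left zero_le_mult_iff)
  then show False
    using d(2)[of "d / 2"] d(1) by simp
qed

text \<open>Strong monotonicity of the regularized operator with modulus
  \<open>\<epsilon> t\<close>. It yields uniqueness, boundedness and the comparison of the flow with
  the regularized solutions.\<close>

lemma \<Phi>_dissipative:
  assumes "monotone_operator F" "\<epsilon> t \<ge> 0"
  shows "(\<Phi> F \<epsilon> z0 x t - \<Phi> F \<epsilon> z0 y t) \<bullet> (x - y) \<le> - \<epsilon> t * (norm (x - y))\<^sup>2"
proof -
  have "\<Phi> F \<epsilon> z0 x t - \<Phi> F \<epsilon> z0 y t = - (F x - F y) - \<epsilon> t *\<^sub>R (x - y)"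
    by (simp add: \<Phi>_def algebra_simps)
  then show ?thesis
    using assms unfolding monotone_operator_def
    by (simp add: inner_diff_left power2_norm_eq_inner inner_minus_left)
qed

text \<open>The ball around \<open>y\<close> through \<open>z0\<close> is invariant: outside it the
  dissipation outweighs the pull towards \<open>z0\<close>.\<close>

lemma solution_bounded:
  fixes F :: "'a::real_inner \<Rightarrow> 'a"
  assumes z: "solves_Cauchy_problem (\<Phi> F \<epsilon> z0) z0 z"
    and mono: "monotone_operator F" and y: "F y = 0"
    and \<epsilon>: "continuous_on {0..} \<epsilon>" "\<And>t. t \<ge> 0 \<Longrightarrow> \<epsilon> t \<ge> 0"
    and t: "t \<ge> 0"
  shows "norm (z t - y) \<le> norm (z0 - y)"
proof -
  obtain A where A: "\<And>t. t \<ge> 0 \<Longrightarrow> (A has_real_derivative \<epsilon> t) (at t within {0..})"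
    using antiderivative_exists[OF \<epsilon>(1)] by (metis has_real_derivative_iff_has_vector_derivative)
  \<comment> \<open>The level \<open>K\<close> equals the initial value, so the exponential term
    vanishes.\<close>
  have "(norm (z t - y))\<^sup>2 \<le> (norm (z0 - y))\<^sup>2 + ((norm (z 0 - y))\<^sup>2 - (norm (z0 - y))\<^sup>2) * exp (A 0 - A t)"
  proof (rule gronwall_affine[where a = \<epsilon> and t = t, OF DERIV_norm_power2 A _ t])
    fix t :: real assume t: "t \<ge> 0"
    show "((\<lambda>t. z t - y) has_vector_derivative \<Phi> F \<epsilon> z0 (z t) t) (at t within {0..})"
      using z t unfolding solves_Cauchy_problem_def by (auto intro!: derivative_eq_intros)
    define d where "d = z t - y"
    \<comment> \<open>Since \<open>F y = 0\<close>, the field at \<open>y\<close> is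
      \<open>\<epsilon> t *\<^sub>R (z0 - y)\<close>; this accounts for the last term.\<close>
    have "\<Phi> F \<epsilon> z0 (z t) t \<bullet> d \<le> - \<epsilon> t * (norm d)\<^sup>2 + \<epsilon> t * ((z0 - y) \<bullet> d)"
      using \<Phi>_dissipative[where \<epsilon> = \<epsilon> and t = t, OF mono \<epsilon>(2)[OF t], of z0 "z t" y] y
      by (simp add: d_def \<Phi>_def inner_diff_left inner_add_left algebra_simps)
    moreover have "2 * ((z0 - y) \<bullet> d) \<le> (norm (z0 - y))\<^sup>2 + (norm d)\<^sup>2"
      using norm_cauchy_schwarz[of "z0 - y" d] sum_squares_bound[of "norm (z0 - y)" "norm d"]
      by (simp add: mult_ac)
    then have "\<epsilon> t * (2 * ((z0 - y) \<bullet> d)) \<le> \<epsilon> t * ((norm (z0 - y))\<^sup>2 + (norm d)\<^sup>2)"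
      using \<epsilon>(2)[OF t] by (rule mult_left_mono)
    ultimately show "2 * (\<Phi> F \<epsilon> z0 (z t) t \<bullet> (z t - y)) \<le> - \<epsilon> t * ((norm (z t - y))\<^sup>2 - (norm (z0 - y))\<^sup>2)"
      unfolding d_def[symmetric] by (simp add: algebra_simps)
  qed
  then have "(norm (z t - y))\<^sup>2 \<le> (norm (z0 - y))\<^sup>2"
    using z by (simp add: solves_Cauchy_problem_def)
  then show ?thesis
    by (rule power2_le_imp_le) simp
qed

text \<open>Eventually \<open>\<epsilon>' / \<epsilon> > - \<epsilon>\<close>, so
  \<open>A + ln \<epsilon>\<close> is nondecreasing; as \<open>ln \<epsilon>\<close> tends to minus
  infinity, \<open>A\<close> must tend to infinity.\<close>

lemma antiderivative_at_top:
  fixes A \<epsilon> \<epsilon>' :: "real \<Rightarrow> real"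
  assumes A: "\<And>t. t \<ge> 0 \<Longrightarrow> (A has_real_derivative \<epsilon> t) (at t within {0..})"
    and pos: "\<And>t. t \<ge> 0 \<Longrightarrow> \<epsilon> t > 0"
    and \<epsilon>': "\<And>t. t \<ge> 0 \<Longrightarrow> (\<epsilon> has_real_derivative \<epsilon>' t) (at t within {0..})"
    and lim: "(\<epsilon> \<longlongrightarrow> 0) at_top"
    and ratio: "((\<lambda>t. \<epsilon>' t / (\<epsilon> t)\<^sup>2) \<longlongrightarrow> 0) at_top"
  shows "filterlim A at_top at_top"
proof -
  have "eventually (\<lambda>t. \<epsilon>' t / (\<epsilon> t)\<^sup>2 > -1) at_top"
    using order_tendstoD(1)[OF ratio, of "-1"] by simp
  then obtain t1 where t1: "\<And>t. t \<ge> t1 \<Longrightarrow> \<epsilon>' t / (\<epsilon> t)\<^sup>2 > -1"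
    unfolding eventually_at_top_linorder by blast
  define t0 where "t0 = max 0 t1"
  have le: "A t0 + ln (\<epsilon> t0) - ln (\<epsilon> t) \<le> A t" if t: "t \<ge> t0" for t
  proof -
    have "- (A t + ln (\<epsilon> t)) \<le> 0 + (- (A t0 + ln (\<epsilon> t0)) - 0) * exp (0 - 0)"
    proof (rule gronwall_affine[where a = "\<lambda>_. 0" and t = t and t0 = t0])
      fix s assume s: "s \<ge> t0"
      then have s0: "s \<ge> 0" "s \<ge> t1"
        by (auto simp: t0_def)
      show "((\<lambda>t. - (A t + ln (\<epsilon> t))) has_real_derivative - (\<epsilon> s + \<epsilon>' s / \<epsilon> s)) (at s within {t0..})"
        by (rule DERIV_subset[of _ _ _ "{0..}"])
           (use A[OF s0(1)] \<epsilon>'[OF s0(1)] pos[OF s0(1)] in \<open>auto intro!: derivative_eq_intros simp: t0_def\<close>)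
      have "- \<epsilon> s * \<epsilon> s \<le> \<epsilon>' s"
        using t1[OF s0(2)] pos[OF s0(1)] by (simp add: field_simps power2_eq_square)
      then show "- (\<epsilon> s + \<epsilon>' s / \<epsilon> s) \<le> - 0 * (- (A s + ln (\<epsilon> s)) - 0)"
        using pos[OF s0(1)] by (simp add: field_simps)
    qed (use t in auto)
    then show ?thesis
      by simp
  qed
  have "eventually (\<lambda>t. \<epsilon> t > 0) at_top"
    using eventually_ge_at_top[of 0] by eventually_elim (rule pos)
  then have "filterlim \<epsilon> (at_right 0) at_top"
    using lim by (simp add: filterlim_at eventually_mono)
  then have "filterlim (\<lambda>t. ln (\<epsilon> t)) at_bot at_top"
    by (rule filterlim_compose[OF ln_at_0])
  then have "filterlim (\<lambda>t. - ln (\<epsilon> t)) at_top at_top"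
    by (simp add: filterlim_uminus_at_top)
  then have "filterlim (\<lambda>t. (A t0 + ln (\<epsilon> t0)) + - ln (\<epsilon> t)) at_top at_top"
    by (rule filterlim_tendsto_add_at_top[OF tendsto_const])
  then show ?thesis
  proof (rule filterlim_at_top_mono)
    show "eventually (\<lambda>t. A t0 + ln (\<epsilon> t0) + - ln (\<epsilon> t) \<le> A t) at_top"
      using eventually_ge_at_top[of t0] by eventually_elim (use le in simp)
  qed
qed

text \<open>Differentiating the equation gives \<open>z'' = - F'(z) z' - \<epsilon> z' - \<epsilon>' (z - z0)\<close> with \<open>F'(z) \<ge> 0\<close>,
  so \<open>Q = \<parallel>z'\<parallel>\<^sup>2 / \<epsilon>\<^sup>2\<close> satisfies, with \<open>\<rho> = \<bar>\<epsilon>'\<bar> / \<epsilon>\<^sup>2\<close> and a bound \<open>R\<close> of \<open>\<parallel>z - z0\<parallel>\<close>,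
  the inequality \<open>Q' \<le> - \<epsilon> ((1 - 2 \<rho>) Q - R\<^sup>2 \<rho>\<^sup>2)\<close>.\<close>

lemma velocity_tendsto:
  fixes F :: "'a::real_inner \<Rightarrow> 'a" and \<epsilon> \<epsilon>' :: "real \<Rightarrow> real"
  assumes z: "solves_Cauchy_problem (\<Phi> F \<epsilon> z0) z0 z"
    and mono: "monotone_operator F"
    and F': "\<And>x. (F has_derivative F' x) (at x)"
    and pos: "\<And>t. t \<ge> 0 \<Longrightarrow> \<epsilon> t > 0"
    and \<epsilon>': "\<And>t. t \<ge> 0 \<Longrightarrow> (\<epsilon> has_real_derivative \<epsilon>' t) (at t within {0..})"
    and lim: "(\<epsilon> \<longlongrightarrow> 0) at_top"
    and ratio: "((\<lambda>t. \<epsilon>' t / (\<epsilon> t)\<^sup>2) \<longlongrightarrow> 0) at_top"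
    and R: "\<And>t. t \<ge> 0 \<Longrightarrow> norm (z t - z0) \<le> R"
  shows "((\<lambda>t. norm (\<Phi> F \<epsilon> z0 (z t) t) / \<epsilon> t) \<longlongrightarrow> 0) at_top"
proof -
  define v where "v t = \<Phi> F \<epsilon> z0 (z t) t" for t
  \<comment> \<open>\<open>w\<close> is the second derivative of the trajectory, as
    \<open>v'\<close> confirms.\<close>
  define w where "w t = - (F' (z t) (v t) + (\<epsilon> t *\<^sub>R v t + \<epsilon>' t *\<^sub>R (z t - z0)))" for t
  define Q where "Q t = (norm (v t))\<^sup>2 / (\<epsilon> t)\<^sup>2" for t
  define \<rho> where "\<rho> t = \<bar>\<epsilon>' t\<bar> / (\<epsilon> t)\<^sup>2" for t
  have z': "(z has_vector_derivative v t) (at t within {0..})" if "t \<ge> 0" for t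
    using z that by (simp add: solves_Cauchy_problem_def v_def)
  have v': "(v has_vector_derivative w t) (at t within {0..})" if t: "t \<ge> 0" for t
  proof -
    have "((\<lambda>t. F (z t)) has_vector_derivative F' (z t) (v t)) (at t within {0..})"
      using vector_derivative_diff_chain_within[OF z'[OF t], of F "F' (z t)"]
        has_derivative_at_withinI[OF F'] by (simp add: comp_def)
    then have "((\<lambda>t. - (F (z t) + \<epsilon> t *\<^sub>R (z t - z0))) has_vector_derivative w t) (at t within {0..})"
      using z'[OF t] \<epsilon>'[OF t] unfolding w_def
      by (auto intro!: derivative_eq_intros simp: algebra_simps)
    then show ?thesis
      unfolding v_def \<Phi>_def .
  qed
  have Q': "(Q has_real_derivative (2 * (w t \<bullet> v t) - 2 * \<epsilon>' t / \<epsilon> t * (norm (v t))\<^sup>2) / (\<epsilon> t)\<^sup>2) (at t within {0..})"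
    if t: "t \<ge> 0" for t
  proof -
    have "((\<lambda>t. (\<epsilon> t)\<^sup>2) has_real_derivative 2 * \<epsilon> t * \<epsilon>' t) (at t within {0..})"
      using DERIV_power[OF \<epsilon>'[OF t], of 2] by (simp add: mult_ac)
    from DERIV_divide[OF DERIV_norm_power2[OF v'[OF t]] this]
    have "(Q has_real_derivative (2 * (w t \<bullet> v t) * (\<epsilon> t)\<^sup>2 - (norm (v t))\<^sup>2 * (2 * \<epsilon> t * \<epsilon>' t)) /
        ((\<epsilon> t)\<^sup>2 * (\<epsilon> t)\<^sup>2)) (at t within {0..})"
      unfolding Q_def[abs_def] using pos[OF t] by simp
    moreover have "(2 * a * e\<^sup>2 - p * (2 * e * e')) / (e\<^sup>2 * e\<^sup>2) = (2 * a - 2 * e' / e * p) / e\<^sup>2"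
      if "e \<noteq> 0" for a p e e' :: real
      using that by (simp add: divide_simps) (simp add: algebra_simps power2_eq_square power4_eq_xxxx)
    ultimately show ?thesis
      using pos[OF t] by simp
  qed
  have Q'_le: "(2 * (w t \<bullet> v t) - 2 * \<epsilon>' t / \<epsilon> t * (norm (v t))\<^sup>2) / (\<epsilon> t)\<^sup>2
      \<le> \<epsilon> t * (- Q t + 2 * \<rho> t * Q t + (R * \<rho> t)\<^sup>2)" if t: "t \<ge> 0" for t
  proof -
    define p e r where "p = norm (v t)" and "e = \<epsilon> t" and "r = \<rho> t"
    have e: "e > 0" and er: "\<bar>\<epsilon>' t\<bar> = r * e\<^sup>2"
      using pos[OF t] by (auto simp: e_def r_def \<rho>_def)
    have "F' (z t) (v t) \<bullet> v t \<ge> 0"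
      by (rule monotone_operator_derivative_nonneg[OF mono F'])
    moreover have "\<bar>\<epsilon>' t * ((z t - z0) \<bullet> v t)\<bar> \<le> \<bar>\<epsilon>' t\<bar> * (R * p)"
      unfolding abs_mult p_def using R[OF t] Cauchy_Schwarz_ineq2[of "z t - z0" "v t"]
      by (intro mult_left_mono order_trans[OF Cauchy_Schwarz_ineq2] mult_right_mono) auto
    ultimately have "w t \<bullet> v t \<le> - e * p\<^sup>2 + r * e\<^sup>2 * (R * p)"
      unfolding w_def er e_def p_def
      by (simp add: inner_minus_left inner_add_left power2_norm_eq_inner del: minus_add_distrib)
    \<comment> \<open>Young's inequality, balanced so that the cross term consumes only half of the
      dissipation \<open>2 * e * p\<^sup>2\<close>.\<close>
    moreover have "2 * (r * e\<^sup>2 * (R * p)) \<le> e * p\<^sup>2 + e * (R * r * e)\<^sup>2"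
      using mult_left_mono[OF sum_squares_bound[of "R * r * e" p], of e] e
      by (simp add: algebra_simps power2_eq_square)
    moreover have "- (2 * \<epsilon>' t / e * p\<^sup>2) \<le> 2 * r * e * p\<^sup>2"
    proof -
      have "- \<epsilon>' t / e \<le> r * e"
        using er e by (simp add: field_simps power2_eq_square)
      then show ?thesis
        using mult_right_mono[of "- \<epsilon>' t / e" "r * e" "2 * p\<^sup>2"] by (simp add: algebra_simps)
    qed
    ultimately have "2 * (w t \<bullet> v t) - 2 * \<epsilon>' t / e * p\<^sup>2 \<le> - e * p\<^sup>2 + e * (R * r * e)\<^sup>2 + 2 * r * e * p\<^sup>2"
      by linarith
    then have "(2 * (w t \<bullet> v t) - 2 * \<epsilon>' t / e * p\<^sup>2) / e\<^sup>2 \<le> (- e * p\<^sup>2 + e * (R * r * e)\<^sup>2 + 2 * r * e * p\<^sup>2) / e\<^sup>2"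
      by (rule divide_right_mono) simp
    also have "\<dots> = e * (- (p\<^sup>2 / e\<^sup>2) + 2 * r * (p\<^sup>2 / e\<^sup>2) + (R * r)\<^sup>2)"
      using e by (simp add: field_simps power2_eq_square)
    finally show ?thesis
      by (simp add: p_def e_def r_def Q_def)
  qed
  have "continuous_on {0..} \<epsilon>"
    using \<epsilon>' by (auto intro: DERIV_continuous_on)
  then obtain A where A: "\<And>t. t \<ge> 0 \<Longrightarrow> (A has_real_derivative \<epsilon> t) (at t within {0..})"
    using antiderivative_exists by (metis has_real_derivative_iff_has_vector_derivative)
  have A_top: "filterlim A at_top at_top"
    by (rule antiderivative_at_top[OF A pos \<epsilon>' lim ratio])
  have \<rho>_lim: "(\<rho> \<longlongrightarrow> 0) at_top"
    using tendsto_rabs_zero[OF ratio] by (simp add: \<rho>_def[abs_def] abs_divide)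
  have "(Q \<longlongrightarrow> 0) at_top"
  proof (rule tendstoI)
    fix \<kappa> :: real assume \<kappa>: "\<kappa> > 0"
    have "((\<lambda>t. (R * \<rho> t)\<^sup>2) \<longlongrightarrow> (R * 0)\<^sup>2) at_top"
      by (intro tendsto_intros \<rho>_lim)
    \<comment> \<open>The bound \<open>\<rho> < 1/4\<close> leaves the damping \<open>Q / 2\<close>,
      and a forcing below \<open>\<kappa> / 4\<close> then sets the level
      \<open>\<kappa> / 2\<close>, strictly below \<open>\<kappa>\<close>.\<close>
    then have "eventually (\<lambda>t. (R * \<rho> t)\<^sup>2 < \<kappa> / 4) at_top"
      using order_tendstoD(2)[of "\<lambda>t. (R * \<rho> t)\<^sup>2" 0 at_top "\<kappa> / 4"] \<kappa> by simp
    moreover have "eventually (\<lambda>t. \<rho> t < 1/4) at_top"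
      using order_tendstoD(2)[OF \<rho>_lim, of "1/4"] by simp
    ultimately have "eventually (\<lambda>t. t \<ge> 0 \<and> (R * \<rho> t)\<^sup>2 < \<kappa> / 4 \<and> \<rho> t < 1/4) at_top"
      using eventually_ge_at_top[of 0] by eventually_elim auto
    then obtain t0 where t0: "\<And>t. t \<ge> t0 \<Longrightarrow> t \<ge> 0 \<and> (R * \<rho> t)\<^sup>2 < \<kappa> / 4 \<and> \<rho> t < 1/4"
      unfolding eventually_at_top_linorder by blast
    have t0_sub: "{t0..} \<subseteq> {0..}"
      using t0[of t0] by auto
    have le: "Q t \<le> \<kappa> / 2 + (Q t0 - \<kappa> / 2) * exp (A t0 / 2 - A t / 2)" if t: "t \<ge> t0" for t
    proof (rule gronwall_affine[where a = "\<lambda>t. \<epsilon> t / 2" and t = t and t0 = t0])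
      fix s assume s: "s \<ge> t0"
      have s': "s \<ge> 0" "(R * \<rho> s)\<^sup>2 < \<kappa> / 4" "\<rho> s < 1/4"
        using t0[OF s] by auto
      show "(Q has_real_derivative (2 * (w s \<bullet> v s) - 2 * \<epsilon>' s / \<epsilon> s * (norm (v s))\<^sup>2) / (\<epsilon> s)\<^sup>2) (at s within {t0..})"
        using Q'[of s] s' t0_sub by (blast intro: DERIV_subset)
      show "((\<lambda>t. A t / 2) has_real_derivative \<epsilon> s / 2) (at s within {t0..})"
        using A[of s] s' t0_sub by (blast intro: DERIV_subset DERIV_cdivide)
      have "2 * \<rho> s * Q s \<le> 1/2 * Q s"
        using s' by (intro mult_right_mono) (auto simp: Q_def)
      moreover have "- q + b + x \<le> - (1/2) * (q - \<kappa> / 2)" if "b \<le> 1/2 * q" "x < \<kappa> / 4" for q b x :: real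
        using that by (simp add: right_diff_distrib)
      ultimately have "- Q s + 2 * \<rho> s * Q s + (R * \<rho> s)\<^sup>2 \<le> - (1/2) * (Q s - \<kappa> / 2)"
        using s'(2) by blast
      then have "\<epsilon> s * (- Q s + 2 * \<rho> s * Q s + (R * \<rho> s)\<^sup>2) \<le> \<epsilon> s * (- (1/2) * (Q s - \<kappa> / 2))"
        using s' pos[of s] by (intro mult_left_mono) auto
      then show "(2 * (w s \<bullet> v s) - 2 * \<epsilon>' s / \<epsilon> s * (norm (v s))\<^sup>2) / (\<epsilon> s)\<^sup>2 \<le> - (\<epsilon> s / 2) * (Q s - \<kappa> / 2)"
        using Q'_le[of s] s' by simp
    qed (use t in auto)
    have "filterlim (\<lambda>t. - A t / 2 + A t0 / 2) at_bot at_top"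
    proof -
      have "filterlim (\<lambda>t. 1/2 * A t) at_top at_top"
        by (rule filterlim_tendsto_pos_mult_at_top[OF tendsto_const _ A_top]) simp
      then have "filterlim (\<lambda>t. - A t0 / 2 + 1/2 * A t) at_top at_top"
        by (rule filterlim_tendsto_add_at_top[OF tendsto_const])
      then show ?thesis
        by (simp add: filterlim_uminus_at_top)
    qed
    \<comment> \<open>Divergence of the integral of \<open>\<epsilon>\<close> is what makes the
      initial value of \<open>Q\<close> be forgotten.\<close>
    then have "((\<lambda>t. exp (A t0 / 2 - A t / 2)) \<longlongrightarrow> 0) at_top"
      using filterlim_compose[OF exp_at_bot] by fastforce
    then have "((\<lambda>t. \<kappa> / 2 + (Q t0 - \<kappa> / 2) * exp (A t0 / 2 - A t / 2)) \<longlongrightarrow> \<kappa> / 2 + (Q t0 - \<kappa> / 2) * 0) at_top"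
      by (intro tendsto_intros)
    then have "eventually (\<lambda>t. \<kappa> / 2 + (Q t0 - \<kappa> / 2) * exp (A t0 / 2 - A t / 2) < \<kappa>) at_top"
      by (rule order_tendstoD) (use \<kappa> in simp)
    then show "eventually (\<lambda>t. dist (Q t) 0 < \<kappa>) at_top"
      using eventually_ge_at_top[of t0]
    proof eventually_elim
      case (elim t)
      then show ?case
        using le[of t] by (simp add: Q_def)
    qed
  qed
  then have "((\<lambda>t. sqrt (Q t)) \<longlongrightarrow> sqrt 0) at_top"
    by (intro tendsto_intros)
  moreover have "eventually (\<lambda>t. sqrt (Q t) = norm (v t) / \<epsilon> t) at_top"
    using eventually_ge_at_top[of 0]
    by eventually_elim (use pos in \<open>auto simp: Q_def real_sqrt_divide abs_of_pos\<close>)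
  ultimately show ?thesis
    unfolding v_def using tendsto_cong by fastforce
qed

theorem theorem3p17:
  fixes F :: "'a::{real_inner, complete_space} \<Rightarrow> 'a"
    and F' :: "'a \<Rightarrow> 'a \<Rightarrow>\<^sub>L 'a"
    and y z0 :: 'a
    and N1 :: real
    and \<epsilon> \<epsilon>' :: "real \<Rightarrow> real"
  assumes y_solution: "F y = 0"
    and y_unique: "\<And>z. F z = 0 \<Longrightarrow> z = y"
    and F_wcont: "w_continuous F"
    and F_mono: "monotone_operator F"
    and F_deriv: "\<And>x. (F has_derivative blinfun_apply (F' x)) (at x)"
    and F'_cont: "continuous_on UNIV F'"
    and F'_bound: "\<And>x. norm (F' x) \<le> N1"
    and eps_pos: "\<And>t. t \<ge> 0 \<Longrightarrow> \<epsilon> t > 0"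
    and eps_deriv: "\<And>t. t \<ge> 0 \<Longrightarrow> (\<epsilon> has_real_derivative \<epsilon>' t) (at t within {0..})"
    and eps'_cont: "continuous_on {0..} \<epsilon>'"
    and eps_antimono: "antimono_on {0..} \<epsilon>"
    and eps_lim: "(\<epsilon> \<longlongrightarrow> 0) at_top"
    and eps_ratio: "((\<lambda>t. \<epsilon>' t / (\<epsilon> t)\<^sup>2) \<longlongrightarrow> 0) at_top"
  shows "\<exists>z. solves_Cauchy_problem (\<Phi> F \<epsilon> z0) z0 z
           \<and> (\<forall>w. solves_Cauchy_problem (\<Phi> F \<epsilon> z0) z0 w \<longrightarrow> (\<forall>t\<ge>0. w t = z t))
           \<and> ((\<lambda>t. norm (z t - y)) \<longlongrightarrow> 0) at_top"
proof -
  have N1: "N1 \<ge> 0"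
    using order_trans[OF norm_ge_zero F'_bound] .
  have "onorm (blinfun_apply (F' x)) \<le> N1" for x
    using F'_bound[of x] by (simp add: norm_blinfun.rep_eq)
  \<comment> \<open>The derivative bound becomes a global Lipschitz bound by the mean value
    inequality on the convex whole space.\<close>
  then have F_lip: "norm (F u - F v) \<le> N1 * norm (u - v)" for u v
    by (rule differentiable_bound[OF convex_UNIV F_deriv]) simp_all
  have "isCont F x" for x
    by (rule has_derivative_continuous[OF F_deriv])
  then have F_cont: "continuous_on UNIV F"
    by (simp add: continuous_at_imp_continuous_on)
  have eps_cont: "continuous_on {0..} \<epsilon>"
    using eps_deriv by (auto intro: DERIV_continuous_on)
  have eps_le: "\<epsilon> t \<le> \<epsilon> 0" if "t \<ge> 0" for t
    using monotone_onD[OF eps_antimono, of 0 t] that by simp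

  obtain z where z: "solves_Cauchy_problem (\<Phi> F \<epsilon> z0) z0 z"
  proof -
    have "\<exists>z. solves_Cauchy_problem (\<Phi> F \<epsilon> z0) z0 z"
    \<comment> \<open>Since \<open>\<epsilon>\<close> decreases, \<open>\<epsilon> 0\<close> makes
      the Lipschitz constant uniform in time; at \<open>z0\<close> the regularizing term vanishes,
      leaving \<open>norm (F z0)\<close>.\<close>
    proof (rule Cauchy_problem_exists[where L = "N1 + \<epsilon> 0" and B = "norm (F z0)"])
      have "continuous_on (UNIV \<times> {0..}) (\<lambda>x. \<epsilon> (snd x))"
        by (rule continuous_on_compose2[OF eps_cont]) (auto intro!: continuous_intros)
      moreover have "continuous_on (UNIV \<times> {0..}) (\<lambda>x::'a \<times> real. F (fst x))"
        by (rule continuous_on_compose2[OF F_cont]) (auto intro!: continuous_intros)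
      ultimately show "continuous_on (UNIV \<times> {0..}) (\<lambda>(x, t). \<Phi> F \<epsilon> z0 x t)"
        unfolding \<Phi>_def case_prod_beta by (intro continuous_intros)
      fix u v :: 'a and t :: real
      assume t: "t \<ge> 0"
      have "norm (\<Phi> F \<epsilon> z0 u t - \<Phi> F \<epsilon> z0 v t) = norm ((F u - F v) + \<epsilon> t *\<^sub>R (u - v))"
        unfolding \<Phi>_def by (subst norm_minus_cancel[symmetric]) (simp add: algebra_simps)
      also have "\<dots> \<le> N1 * norm (u - v) + \<epsilon> 0 * norm (u - v)"
        using eps_le[OF t] eps_pos[OF t]
        by (intro order_trans[OF norm_triangle_ineq] add_mono F_lip) (simp add: mult_right_mono)
      finally show "norm (\<Phi> F \<epsilon> z0 u t - \<Phi> F \<epsilon> z0 v t) \<le> (N1 + \<epsilon> 0) * norm (u - v)"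
        by (simp add: distrib_right)
    qed (use N1 eps_pos[of 0] in \<open>auto simp: \<Phi>_def\<close>)
    then show ?thesis
      using that by blast
  qed

  have unique: "w t = z t" if w: "solves_Cauchy_problem (\<Phi> F \<epsilon> z0) z0 w" and t: "t \<ge> 0" for w t
  proof (rule Cauchy_problem_unique[OF z w _ t])
    fix u v :: 'a and s :: real
    assume s: "s \<ge> 0"
    have "- \<epsilon> s * (norm (u - v))\<^sup>2 \<le> 0"
      using eps_pos[OF s] by simp
    then show "(\<Phi> F \<epsilon> z0 u s - \<Phi> F \<epsilon> z0 v s) \<bullet> (u - v) \<le> 0"
      using \<Phi>_dissipative[where \<epsilon> = \<epsilon> and t = s, OF F_mono less_imp_le[OF eps_pos[OF s]]] order_trans by blast
  qed

  have "\<forall>e. \<exists>v. e > 0 \<longrightarrow> F v + e *\<^sub>R (v - z0) = 0"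
    using regularized_solution_exists[OF F_mono F_lip N1] by blast
  then obtain V where V: "\<And>e. e > 0 \<Longrightarrow> F (V e) + e *\<^sub>R (V e - z0) = 0"
    using choice by metis
  have "eventually (\<lambda>t. \<epsilon> t > 0) at_top"
    using eventually_ge_at_top[of 0] by eventually_elim (rule eps_pos)
  then have "filterlim \<epsilon> (at_right 0) at_top"
    using eps_lim by (simp add: filterlim_at eventually_mono)
  moreover have "(V \<longlongrightarrow> y) (at_right 0)"
    by (rule regularized_solution_tendsto[OF F_mono F_cont y_solution y_unique V])
  ultimately have "((\<lambda>t. V (\<epsilon> t)) \<longlongrightarrow> y) at_top"
    using filterlim_compose by blast
  then have V_lim: "((\<lambda>t. norm (V (\<epsilon> t) - y)) \<longlongrightarrow> 0) at_top"
    by (intro tendsto_norm_zero LIM_zero)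

  have z_bound: "norm (z t - z0) \<le> 2 * norm (z0 - y)" if t: "t \<ge> 0" for t
  proof -
    have "norm (z t - y) \<le> norm (z0 - y)"
      by (rule solution_bounded[OF z F_mono y_solution eps_cont _ t]) (use eps_pos less_imp_le in blast)
    then show ?thesis
      using norm_triangle_ineq4[of "z t - y" "z0 - y"] by simp
  qed
  have velocity: "((\<lambda>t. norm (\<Phi> F \<epsilon> z0 (z t) t) / \<epsilon> t) \<longlongrightarrow> 0) at_top"
    by (rule velocity_tendsto[OF z F_mono F_deriv eps_pos eps_deriv eps_lim eps_ratio z_bound])
  have bound: "norm (z t - y) \<le> norm (\<Phi> F \<epsilon> z0 (z t) t) / \<epsilon> t + norm (V (\<epsilon> t) - y)" if t: "t \<ge> 0" for t
  proof -
    define d where "d = z t - V (\<epsilon> t)"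
    note pos = eps_pos[OF t]
    have "\<Phi> F \<epsilon> z0 (V (\<epsilon> t)) t = 0"
      using V[OF pos] by (simp add: \<Phi>_def)
    \<comment> \<open>\<open>V (\<epsilon> t)\<close> is a zero of the field frozen at time
      \<open>t\<close>, so dissipativity bounds the distance to it by the velocity divided by
      \<open>\<epsilon> t\<close>.\<close>
    then have "\<epsilon> t * (norm d)\<^sup>2 \<le> - (\<Phi> F \<epsilon> z0 (z t) t \<bullet> d)"
      using \<Phi>_dissipative[where \<epsilon> = \<epsilon> and t = t, OF F_mono less_imp_le[OF pos], of z0 "z t" "V (\<epsilon> t)"]
      by (simp add: d_def)
    also have "\<dots> \<le> norm (\<Phi> F \<epsilon> z0 (z t) t) * norm d"
      using Cauchy_Schwarz_ineq2[of "\<Phi> F \<epsilon> z0 (z t) t" d] by linarith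
    finally have "(\<epsilon> t * norm d) * norm d \<le> norm (\<Phi> F \<epsilon> z0 (z t) t) * norm d"
      by (simp add: power2_eq_square mult.assoc)
    then have "\<epsilon> t * norm d \<le> norm (\<Phi> F \<epsilon> z0 (z t) t)"
      by (cases "d = 0") simp_all
    then have "norm d \<le> norm (\<Phi> F \<epsilon> z0 (z t) t) / \<epsilon> t"
      using pos by (simp add: pos_le_divide_eq mult.commute)
    then show ?thesis
      using norm_triangle_ineq[of d "V (\<epsilon> t) - y"] by (simp add: d_def)
  qed
  have "eventually (\<lambda>t. norm (norm (z t - y)) \<le> norm (\<Phi> F \<epsilon> z0 (z t) t) / \<epsilon> t + norm (V (\<epsilon> t) - y)) at_top"
    using eventually_ge_at_top[of 0] by eventually_elim (use bound in simp)
  then have "((\<lambda>t. norm (z t - y)) \<longlongrightarrow> 0) at_top"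
    by (rule Lim_null_comparison) (use tendsto_add[OF velocity V_lim] in simp)
  with z unique show ?thesis
    by blast
qed

end
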